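(* Let $C\subset\mathbb{R}^n$ be a proper open convex cone and let $f\in\mathscr{H}^{*\,o}_{C}$. If the distributional boundary value $BV(f(z))$ of $f$ in the sense of tempered ultrahyperfunctions vanishes, then $f$ itself vanishes identically.
   Context: Notation: $|x|=|x_1|+\dots+|x_n|$, $\langle x,y\rangle=\sum_i x_iy_i$, $z=x+iy\in\mathbb{C}^n$; $B(0;r)$ is the open ball of radius $r$ about $0$ in $\mathbb{R}^n$. Cones. An open set $C\subset\mathbb{R}^n$ is a cone if $\mathbb{R}_+\cdot C\subset C$; it is convex if $C+C\subset C$ and proper if it contains no straight line. A cone $C'$ is compact in $C$, written $C'\Subset C$, if $\overline{C'}\cap S^{n-1}\subset C\cap S^{n-1}$, where $S^{n-1}$ is the unit sphere. The dual cone is $C^*=\{\xi\in\mathbb{R}^n:\langle\xi,y\rangle\ge 0\ \forall y\in C\}$, and $h_{C^*}(y)=\sup_{\xi\in C^*}\langle\xi,y\rangle$. For a set $\Omega\subset\mathbb{R}^n$, $T(\Omega)=\mathbb{R}^n+i\Omega\subset\mathbb{C}^n$. Space of holomorphic functions. $\mathscr{H}^{*\,o}_{C}$ is the set of functions $f$ holomorphic in $T(C')=\mathbb{R}^n+iC'$ and satisfying $$|f(z)|\le M(C')(1+|z|)^N e^{h_{C^*}(y)},\qquad z\in T(C';r)=\mathbb{R}^n+i\bigl(C'\setminus(C'\cap B(0;r))\bigr),$$ where $C'\Subset C$ is an arbitrary compact subcone, $r$ is an arbitrary positive real number, $M(C')$ is a constant depending on $C'$, and $N$ is a non-negative real number.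 Test functions and tempered ultrahyperfunctions. For a convex compact $K\subset\mathbb{R}^n$, $\mathfrak{H}_b(T(K))$ is the space of continuous functions $\varphi$ on $T(K)$, holomorphic in the interior of $T(K)$, such that $\sup_{z\in T(K)}(1+|z|)^N|\varphi(z)|<\infty$ for every $N=0,1,2,\dots$, with these seminorms. $\mathfrak{H}(T(\mathbb{R}^n))=\lim\mathrm{proj}_{K}\mathfrak{H}_b(T(K))$, $K$ ranging over all convex compact subsets of $\mathbb{R}^n$; it consists of entire functions rapidly decreasing in any horizontal strip. A tempered ultrahyperfunction is a continuous linear functional on $\mathfrak{H}(T(\mathbb{R}^n))$. Boundary values. $f\in\mathscr{H}^{*\,o}_{C}$ has boundary value $U=BV(f(z))$ in the sense of tempered ultrahyperfunctions if for all $\psi\in\mathfrak{H}(T(\mathbb{R}^n))$ $$\langle U,\psi\rangle=\lim_{y\to 0,\ y\in C'}\int_{\mathbb{R}^n}f(x+iy)\psi(x)\,d^nx$$ exists, for $C'\Subset C$.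
   Formalization: Since h_{C*}(y) is +∞ for every y in a nonempty proper open convex cone C, the growth bound is read with a finite exponent: e^{h_{C*}(y)} is replaced by e^{H(y)} for some finite continuous function H ≤ h_{C*} on C, which may depend on f. *)

theory Defs
  imports "HOL-Analysis.Analysis"
begin

section \<open>Cones\<close>

definition open_cone :: "(real ^ 'n) set \<Rightarrow> bool" where
  "open_cone C \<longleftrightarrow> open C \<and> (\<forall>t>0. \<forall>y\<in>C. t *\<^sub>R y \<in> C)"

definition convex_cone_sum :: "(real ^ 'n) set \<Rightarrow> bool" where
  "convex_cone_sum C \<longleftrightarrow> (\<forall>x\<in>C. \<forall>y\<in>C. x + y \<in> C)"

definition proper_cone :: "(real ^ 'n) set \<Rightarrow> bool" where
  "proper_cone C \<longleftrightarrow> \<not> (\<exists>x v. v \<noteq> 0 \<and> (\<forall>t::real. x + t *\<^sub>R v \<in> C))"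

definition compact_subcone :: "(real ^ 'n) set \<Rightarrow> (real ^ 'n) set \<Rightarrow> bool" where
  "compact_subcone C' C \<longleftrightarrow>
     open_cone C' \<and> closure C' \<inter> sphere 0 1 \<subseteq> C \<inter> sphere 0 1"

definition dual_cone :: "(real ^ 'n) set \<Rightarrow> (real ^ 'n) set" where
  "dual_cone C = {\<xi>. \<forall>y\<in>C. 0 \<le> \<xi> \<bullet> y}"

text \<open>The supremum may be infinite, so it is taken in the extended reals.\<close>

definition support_fun :: "(real ^ 'n) set \<Rightarrow> real ^ 'n \<Rightarrow> ereal" where
  "support_fun S y = (SUP \<xi>\<in>S. ereal (\<xi> \<bullet> y))"


section \<open>Tubes and holomorphic functions of several variables\<close>

definition cvec :: "real ^ 'n \<Rightarrow> real ^ 'n \<Rightarrow> complex ^ 'n" where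
  "cvec x y = (\<chi> j. Complex (x $ j) (y $ j))"

definition tube :: "(real ^ 'n) set \<Rightarrow> (complex ^ 'n) set" where
  "tube \<Omega> = {cvec x y | x y. y \<in> \<Omega>}"

definition l1_norm :: "complex ^ 'n \<Rightarrow> real" where
  "l1_norm z = (\<Sum>j\<in>UNIV. cmod (z $ j))"

text \<open>Complex Frechet differentiability at every point; only used for open sets.\<close>

definition holomorphic_several :: "(complex ^ 'n \<Rightarrow> complex) \<Rightarrow> (complex ^ 'n) set \<Rightarrow> bool" where
  "holomorphic_several f S \<longleftrightarrow>
     (\<forall>z\<in>S. \<exists>D. (f has_derivative D) (at z) \<and> (\<forall>c v. D (c *s v) = c * D v))"


section \<open>The space of holomorphic functions attached to a cone\<close>

text \<open>
  The growth condition is \<open>\<bar>f(z)\<bar> \<le> M(C') (1 + \<bar>z\<bar>)\<^sup>N exp (h(y))\<close> with \<open>h\<close> the support function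
  of the dual cone. For a proper cone \<open>C\<close> this \<open>h\<close> is infinite on all of \<open>C\<close>, and an estimate
  with infinite right-hand side says nothing. It is therefore read as an estimate with finite
  right-hand side: the exponent is a finite continuous function \<open>H\<close> on \<open>C\<close> with
  \<open>H(y) \<le> h(y)\<close>. If \<open>h\<close> is finite and continuous on \<open>C\<close> this is the condition with \<open>h\<close> itself
  (take \<open>H = h\<close>).
\<close>

definition growth_space :: "(real ^ 'n) set \<Rightarrow> (complex ^ 'n \<Rightarrow> complex) set" where
  "growth_space C = {f.
     (\<forall>C'. compact_subcone C' C \<longrightarrow> holomorphic_several f (tube C')) \<and>
     (\<exists>N H. 0 \<le> N \<and> continuous_on C H \<and>
        (\<forall>y\<in>C. ereal (H y) \<le> support_fun (dual_cone C) y) \<and>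
        (\<forall>C'. compact_subcone C' C \<longrightarrow>
           (\<exists>M. \<forall>r>0. \<forall>x. \<forall>y\<in>C' - (C' \<inter> ball 0 r).
              cmod (f (cvec x y)) \<le> M * (1 + l1_norm (cvec x y)) powr N * exp (H y))))}"


section \<open>Test functions and tempered ultrahyperfunctions\<close>

definition test_space_on :: "(real ^ 'n) set \<Rightarrow> (complex ^ 'n \<Rightarrow> complex) set" where
  "test_space_on K = {\<phi>.
     continuous_on (tube K) \<phi> \<and> holomorphic_several \<phi> (interior (tube K)) \<and>
     (\<forall>N::nat. bdd_above ((\<lambda>z. (1 + l1_norm z) ^ N * cmod (\<phi> z)) ` tube K))}"

definition test_seminorm :: "(real ^ 'n) set \<Rightarrow> nat \<Rightarrow> (complex ^ 'n \<Rightarrow> complex) \<Rightarrow> real" where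
  "test_seminorm K N \<phi> = (SUP z\<in>tube K. (1 + l1_norm z) ^ N * cmod (\<phi> z))"

text \<open>A compatible family over all compact convex \<open>K\<close> is a single function on the whole space.\<close>

definition test_space :: "(complex ^ 'n \<Rightarrow> complex) set" where
  "test_space = {\<phi>. \<forall>K. compact K \<and> convex K \<longrightarrow> \<phi> \<in> test_space_on K}"

text \<open>
  The seminorms form a directed family defining the projective limit topology, so a linear
  functional is continuous iff it is dominated by a multiple of one of them. Functionals are
  HOL functions on all \<open>\<phi>\<close>; only their values on \<open>test_space\<close> matter.
\<close>

definition tempered_ultrahyperfunction :: "((complex ^ 'n \<Rightarrow> complex) \<Rightarrow> complex) \<Rightarrow> bool" where
  "tempered_ultrahyperfunction U \<longleftrightarrow>
     (\<forall>\<phi>\<in>test_space. \<forall>\<psi>\<in>test_space. U (\<lambda>z. \<phi> z + \<psi> z) = U \<phi> + U \<psi>) \<and>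
     (\<forall>c. \<forall>\<phi>\<in>test_space. U (\<lambda>z. c * \<phi> z) = c * U \<phi>) \<and>
     (\<exists>K N B. K \<noteq> {} \<and> compact K \<and> convex K \<and>
        (\<forall>\<phi>\<in>test_space. cmod (U \<phi>) \<le> B * test_seminorm K N \<phi>))"

text \<open>
  For \<open>f\<close> in \<open>growth_space C\<close> and \<open>y \<in> C\<close> the integrand is Lebesgue integrable, by the growth
  condition and the rapid decrease of the test function.
\<close>

definition has_boundary_value ::
  "(real ^ 'n) set \<Rightarrow> (complex ^ 'n \<Rightarrow> complex) \<Rightarrow> ((complex ^ 'n \<Rightarrow> complex) \<Rightarrow> complex) \<Rightarrow> bool"
  where
  "has_boundary_value C f U \<longleftrightarrow> tempered_ultrahyperfunction U \<and>
     (\<forall>\<psi>\<in>test_space. \<forall>C'. compact_subcone C' C \<longrightarrow>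
        ((\<lambda>y. LINT x|lborel. f (cvec x y) * \<psi> (cvec x 0)) \<longlongrightarrow> U \<psi>) (at 0 within C'))"

end

theory Submission
  imports Defs "HOL-Complex_Analysis.Cauchy_Integral_Theorem" "HOL-Probability.Distributions"
begin

text \<open>
  Fix \<open>v \<in> C\<close> and a Gaussian \<open>\<psi>\<close> centred at \<open>a + \<i>v\<close>, which is a test function. Shifting the
  contour along the single direction \<open>v\<close> gives
  \<open>\<integral> f(x + \<i>tv) \<psi>(x) dx = \<integral> f(x + \<i>v) \<psi>(x + \<i>(1 - t)v) dx\<close> for \<open>0 < t \<le> 1\<close>. As \<open>t \<rightarrow> 0\<close> the left-hand side
  tends to the boundary value, which is \<open>0\<close>, and the right-hand side to
  \<open>\<integral> f(x + \<i>v) \<psi>(x + \<i>v) dx\<close>, the integral of \<open>f(\<cdot> + \<i>v)\<close> against a real Gaussian centred at \<open>a\<close>.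
  Narrowing the Gaussian yields \<open>f(a + \<i>v) = 0\<close>. The possible blow-up of \<open>f\<close> near the real space
  plays no role, because only the bound at the height \<open>v\<close> survives the shift.
\<close>

section \<open>Gaussian integrals on Euclidean space\<close>

lemma integrable_gaussian_euclidean:
  "integrable lborel (\<lambda>x::'a::euclidean_space. exp (- (norm x)\<^sup>2 / 4))"
proof (rule integrableI_nonneg)
  have eq: "exp (- (norm x)\<^sup>2 / 4) = (\<Prod>b\<in>Basis. exp (- (x \<bullet> b)\<^sup>2 / 4))" for x :: 'a
  proof -
    have "(norm x)\<^sup>2 = (\<Sum>b\<in>Basis. (x \<bullet> b)\<^sup>2)"
      by (subst power2_norm_eq_inner, subst euclidean_inner) (simp only: power2_eq_square)
    then show ?thesis
      by (simp add: exp_sum[symmetric] sum_negf sum_divide_distrib[symmetric])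
  qed
  \<comment> \<open>Standard deviation sqrt 2 yields the exponent -x^2/4, and the factor 2 * sqrt pi
    cancels the normalising constant.\<close>
  have "integrable lborel (\<lambda>x. normal_density 0 (sqrt 2) x * (2 * sqrt pi))"
    by simp
  then have 1: "integrable lborel (\<lambda>x::real. exp (- x\<^sup>2 / 4))"
    by (simp add: normal_density_def real_sqrt_mult)
  have "(\<integral>\<^sup>+x. ennreal (exp (- (norm (x::'a))\<^sup>2 / 4)) \<partial>lborel)
      = (\<integral>\<^sup>+x. (\<Prod>b\<in>Basis. ennreal (exp (- ((x::'a) \<bullet> b)\<^sup>2 / 4))) \<partial>lborel)"
    unfolding eq by (subst prod_ennreal) auto
  also have "\<dots> = (\<Prod>b\<in>(Basis::'a set). (\<integral>\<^sup>+x. ennreal (exp (- x\<^sup>2 / 4)) \<partial>lborel))"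
    by (rule nn_integral_lborel_prod) auto
  also have "\<dots> < \<infinity>"
    using 1 by (auto simp: integrable_iff_bounded power_less_top_ennreal)
  finally show "(\<integral>\<^sup>+x. ennreal (exp (- (norm (x::'a))\<^sup>2 / 4)) \<partial>lborel) < \<infinity>" .
qed auto

text \<open>With p = norm x and q = norm (x - b), the triangle inequality gives p <= q + \<beta>;
  the squares (q - \<beta>)^2 and (q - c)^2 absorb the cross terms, and -p^2/4 survives. The bound
  depends on b only through \<beta> and not on k, so one integrable majorant serves a bounded family
  of centres.\<close>

lemma gaussian_dominates:
  fixes x b :: "'a::real_normed_vector"
  assumes "norm b \<le> \<beta>" "0 \<le> c" "1 \<le> k"
  shows "exp (c * norm x) * exp (- k * (norm (x - b))\<^sup>2)
    \<le> exp (\<beta>\<^sup>2 / 2 + c\<^sup>2 / 2 + c * \<beta>) * exp (- (norm x)\<^sup>2 / 4)"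
proof -
  define p q where "p = norm x" and "q = norm (x - b)"
  have "norm x \<le> norm (x - b) + norm b"
    by (metis diff_add_cancel norm_triangle_ineq)
  then have p: "0 \<le> p" "0 \<le> q" "p \<le> q + \<beta>" using assms(1) by (auto simp: p_def q_def)
  have "p\<^sup>2 \<le> (q + \<beta>)\<^sup>2" using p by (intro power_mono) auto
  moreover have "0 \<le> (q - \<beta>)\<^sup>2" "0 \<le> (q - c)\<^sup>2" by simp_all
  moreover have "c * p \<le> c * (q + \<beta>)" using p assms by (intro mult_left_mono) auto
  moreover have "q\<^sup>2 \<le> k * q\<^sup>2" using assms mult_right_mono[of 1 k "q\<^sup>2"] by simp
  ultimately have "c * p - k * q\<^sup>2 \<le> (\<beta>\<^sup>2 / 2 + c\<^sup>2 / 2 + c * \<beta>) - p\<^sup>2 / 4"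
    by (simp add: power2_sum power2_diff distrib_left mult.commute[of c q])
  then show ?thesis by (simp add: exp_add[symmetric] p_def q_def)
qed

section \<open>Fubini's theorem and the contour shift in one direction\<close>

lemma integrable_times_Icc:
  fixes p :: "'a::euclidean_space \<Rightarrow> real \<Rightarrow> complex"
  assumes cont: "continuous_on (UNIV \<times> {a..b}) (case_prod p)"
    and B: "integrable lborel B"
    and bound: "\<And>x s. s \<in> {a..b} \<Longrightarrow> cmod (p x s) \<le> B x"
  shows "integrable (lborel \<Otimes>\<^sub>M lborel) (\<lambda>(x, s). indicator {a..b} s *\<^sub>R p x s)"
proof (rule Bochner_Integration.integrable_bound)
  have [measurable]: "B \<in> borel_measurable lborel" using B by (rule borel_measurable_integrable)
  show "integrable (lborel \<Otimes>\<^sub>M lborel) (\<lambda>(x::'a, s). B x * indicator {a..b} s)"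
  proof (rule lborel_pair.Fubini_integrable)
    have "(\<lambda>x. LINT s|lborel. norm (case (x, s) of (x, s) \<Rightarrow> B x * indicator {a..b} s))
       = (\<lambda>x. norm (B x) * measure lborel {a..b})"
      by (auto simp: abs_mult)
    then show "integrable lborel
      (\<lambda>x. LINT s|lborel. norm (case (x, s) of (x, s) \<Rightarrow> B x * indicator {a..b} s))"
      using B by (auto simp del: real_norm_def)
  qed (auto simp: emeasure_lborel_Icc_eq)
  \<comment> \<open>Continuity is assumed only on the closed strip, so measurability is obtained for
    the function cut off by the indicator.\<close>
  have "(\<lambda>z. indicator (UNIV \<times> {a..b}) z *\<^sub>R case_prod p z) \<in> borel_measurable borel"
    using cont by (intro borel_measurable_continuous_on_indicator) (auto intro!: borel_closed closed_Times)
  moreover have "(\<lambda>z. indicator (UNIV \<times> {a..b}) z *\<^sub>R case_prod p z)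
     = (\<lambda>(x, s). indicator {a..b} s *\<^sub>R p x s)"
    by (auto simp: fun_eq_iff indicator_def)
  ultimately show "(\<lambda>(x, s). indicator {a..b} s *\<^sub>R p x s) \<in> borel_measurable (lborel \<Otimes>\<^sub>M lborel)"
    by (simp add: lborel_prod)
  show "AE z in lborel \<Otimes>\<^sub>M lborel. norm (case z of (x, s) \<Rightarrow> indicator {a..b} s *\<^sub>R p x s)
      \<le> norm (case z of (x, s) \<Rightarrow> B x * indicator {a..b} s)"
    using bound order_trans[OF bound abs_ge_self]
    by (intro always_eventually) (auto simp: indicator_def abs_mult)
qed

lemma lborel_integral_translate:
  fixes g :: "'a::euclidean_space \<Rightarrow> complex"
  assumes "g \<in> borel_measurable borel"
  shows "(LINT x|lborel. g (x + c)) = (LINT x|lborel. g x)"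
proof -
  have "(LINT x|lborel. g x) = (LINT x|distr lborel borel ((+) c). g x)"
    by (simp add: lborel_distr_plus)
  also have "\<dots> = (LINT x|lborel. g (x + c))"
    using assms by (subst integral_distr) (auto simp: add.commute)
  finally show ?thesis ..
qed

lemma Fubini_times_Icc:
  fixes p :: "'a::euclidean_space \<Rightarrow> real \<Rightarrow> complex"
  assumes cont: "continuous_on (UNIV \<times> {a..b}) (case_prod p)"
    and B: "integrable lborel B"
    and bound: "\<And>x s. s \<in> {a..b} \<Longrightarrow> cmod (p x s) \<le> B x"
  shows "integrable lborel (\<lambda>x. LINT s|lborel. indicator {a..b} s *\<^sub>R p x s)" (is ?int)
    and "(LINT x|lborel. LINT s|lborel. indicator {a..b} s *\<^sub>R p x s)
       = (LINT s|lborel. indicator {a..b} s *\<^sub>R (LINT x|lborel. p x s))" (is ?eq)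
proof -
  note * = integrable_times_Icc[OF assms]
  show ?int using lborel_pair.integrable_fst'[OF *] by simp
  show ?eq using lborel_pair.Fubini_integral[of "\<lambda>x s. indicator {a..b} s *\<^sub>R p x s"] * by simp
qed

text \<open>Cauchy's theorem on the rectangle with corners \<open>\<i>t\<close> and \<open>1 + \<i>\<close>, integrated over \<open>x\<close>:
  by translation invariance the two vertical sides cancel, and each horizontal side contributes
  its integral at \<open>s = 0\<close>.\<close>

lemma integral_contour_shift:
  fixes h :: "'a::euclidean_space \<Rightarrow> complex \<Rightarrow> complex" and v :: 'a
  assumes shift: "\<And>x s \<zeta>. h x (of_real s + \<zeta>) = h (x + s *\<^sub>R v) \<zeta>"
    and hol: "\<And>x. h x holomorphic_on {\<zeta>. 0 < Im \<zeta>}"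
    and cont: "continuous_on (UNIV \<times> {\<zeta>. 0 < Im \<zeta>}) (case_prod h)"
    and t: "0 < t" "t \<le> 1"
    and B: "integrable lborel B"
    and bound: "\<And>x s \<tau>. 0 \<le> s \<Longrightarrow> s \<le> 1 \<Longrightarrow> t \<le> \<tau> \<Longrightarrow> \<tau> \<le> 1 \<Longrightarrow>
      cmod (h x (of_real s + \<i> * of_real \<tau>)) \<le> B x"
  shows "(LINT x|lborel. h x (\<i> * of_real t)) = (LINT x|lborel. h x \<i>)"
proof -
  define U where "U = {\<zeta>. 0 < Im \<zeta>}"
  define J where "J \<tau> = (LINT x|lborel. h x (\<i> * of_real \<tau>))" for \<tau>
  define Hor where "Hor \<tau> x = (LINT s|lborel. indicator {0..1::real} s *\<^sub>R h x (of_real s + \<i> * of_real \<tau>))"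
    for \<tau> x
  define Ver where "Ver s x = (LINT \<tau>|lborel. indicator {t..1} \<tau> *\<^sub>R h x (of_real s + \<i> * of_real \<tau>))"
    for s x
  have U: "open U" "convex U"
    by (auto simp: U_def open_halfspace_Im_gt convex_halfspace_Im_gt)
  have contx: "continuous_on U (h x)" for x
    using hol holomorphic_on_imp_continuous_on by (auto simp: U_def)
  have joint: "continuous_on (UNIV \<times> S) (\<lambda>(x, y). h x (g y))"
    if "continuous_on S g" "g ` S \<subseteq> U" for S :: "real set" and g
  proof -
    have "continuous_on (UNIV \<times> S) (case_prod h \<circ> (\<lambda>(x, y). (x, g y)))"
    proof (rule continuous_on_compose)
      show "continuous_on (UNIV \<times> S) (\<lambda>(x::'a, y). (x, g y))"
        unfolding split_beta
        by (intro continuous_intros continuous_on_compose2[OF that(1)]) auto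
      show "continuous_on ((\<lambda>(x, y). (x, g y)) ` (UNIV \<times> S)) (case_prod h)"
        using that by (intro continuous_on_subset[OF cont]) (auto simp: U_def)
    qed
    then show ?thesis by (simp add: o_def split_beta)
  qed
  \<comment> \<open>By \<open>shift\<close>, a real displacement s of the argument is a translation
    of x by s v, which Lebesgue measure does not see.\<close>
  have J: "(LINT x|lborel. h x (of_real s + \<i> * of_real \<tau>)) = J \<tau>" if "0 < \<tau>" for s \<tau>
  proof -
    have "continuous_on UNIV (\<lambda>x. case_prod h (x, \<i> * of_real \<tau>))"
      using that by (intro continuous_on_compose2[OF cont] continuous_intros) auto
    then have "(\<lambda>x. h x (\<i> * of_real \<tau>)) \<in> borel_measurable borel"
      by (intro borel_measurable_continuous_onI) simp
    then show ?thesis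
      unfolding shift J_def by (rule lborel_integral_translate)
  qed
  \<comment> \<open>The rectangle has width 1, so integrating the constant \<open>J \<tau>\<close>
    over s returns \<open>J \<tau>\<close> itself.\<close>
  have Hor: "integrable lborel (Hor \<tau>)" "(LINT x|lborel. Hor \<tau> x) = J \<tau>" if \<tau>: "t \<le> \<tau>" "\<tau> \<le> 1" for \<tau>
  proof -
    have c: "continuous_on (UNIV \<times> {0..1}) (\<lambda>(x, s). h x (of_real s + \<i> * of_real \<tau>))"
      using \<tau> t by (intro joint continuous_intros) (auto simp: U_def)
    have b: "cmod (h x (of_real s + \<i> * of_real \<tau>)) \<le> B x" if "s \<in> {0..1}" for x s
      using that \<tau> by (intro bound) auto
    note F = Fubini_times_Icc[OF c B b]
    show "integrable lborel (Hor \<tau>)" unfolding Hor_def by (rule F(1))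
    show "(LINT x|lborel. Hor \<tau> x) = J \<tau>" unfolding Hor_def using F(2) \<tau> t J by simp
  qed
  have Ver: "integrable lborel (Ver s)"
    "(LINT x|lborel. Ver s x) = (LINT \<tau>|lborel. indicator {t..1} \<tau> *\<^sub>R J \<tau>)"
    if s: "0 \<le> s" "s \<le> 1" for s
  proof -
    have c: "continuous_on (UNIV \<times> {t..1}) (\<lambda>(x, \<tau>). h x (of_real s + \<i> * of_real \<tau>))"
      using t by (intro joint continuous_intros) (auto simp: U_def)
    have b: "cmod (h x (of_real s + \<i> * of_real \<tau>)) \<le> B x" if "\<tau> \<in> {t..1}" for x \<tau>
      using that s by (intro bound) auto
    note F = Fubini_times_Icc[OF c B b]
    show "integrable lborel (Ver s)" unfolding Ver_def by (rule F(1))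
    have "(LINT x|lborel. Ver s x) = (LINT \<tau>|lborel. indicator {t..1} \<tau> *\<^sub>R
        (LINT x|lborel. h x (of_real s + \<i> * of_real \<tau>)))" unfolding Ver_def by (rule F(2))
    also have "\<dots> = (LINT \<tau>|lborel. indicator {t..1} \<tau> *\<^sub>R J \<tau>)"
      using t J by (intro Bochner_Integration.integral_cong) (auto simp: indicator_def)
    finally show "(LINT x|lborel. Ver s x) = (LINT \<tau>|lborel. indicator {t..1} \<tau> *\<^sub>R J \<tau>)" .
  qed
  \<comment> \<open>For fixed x there is a primitive P on the convex upper half-plane. Every side is
    an increment of P, with a factor i for the vertical direction, and both sides of the identity
    are the same alternating sum of P over the four corners.\<close>
  have rect: "Hor 1 x - Hor t x = \<i> * (Ver 1 x - Ver 0 x)" for x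
  proof -
    obtain P where P: "\<And>\<zeta>. \<zeta> \<in> U \<Longrightarrow> (P has_field_derivative h x \<zeta>) (at \<zeta> within U)"
      using holomorphic_convex_primitive'[OF U(2,1), of "h x"] hol by (auto simp: U_def)
    have P': "(P has_field_derivative h x \<zeta>) (at \<zeta> within T)" if "\<zeta> \<in> U" for \<zeta> T
      using P[OF that] that U(1) by (metis at_within_open has_field_derivative_at_within)
    have H: "Hor \<tau> x = P (1 + \<i> * of_real \<tau>) - P (\<i> * of_real \<tau>)" if "0 < \<tau>" for \<tau>
    proof -
      have "((\<lambda>s. P (of_real s + \<i> * of_real \<tau>)) has_vector_derivative
          1 * h x (of_real s + \<i> * of_real \<tau>)) (at s within {0..1})" for s :: real
        using that
        by (intro field_vector_diff_chain_within[unfolded o_def] P')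
           (auto intro!: derivative_eq_intros simp: U_def)
      moreover have "continuous_on {0..1} (\<lambda>s. h x (of_real s + \<i> * of_real \<tau>))"
        using that by (intro continuous_on_compose2[OF contx] continuous_intros) (auto simp: U_def)
      ultimately show ?thesis
        unfolding Hor_def
        using integral_FTC_Icc[of 0 1 "\<lambda>s. P (of_real s + \<i> * of_real \<tau>)"
            "\<lambda>s. h x (of_real s + \<i> * of_real \<tau>)"] by simp
    qed
    have V: "\<i> * Ver s x = P (of_real s + \<i>) - P (of_real s + \<i> * of_real t)" for s
    proof -
      have "((\<lambda>\<tau>. P (of_real s + \<i> * of_real \<tau>)) has_vector_derivative
          \<i> * h x (of_real s + \<i> * of_real \<tau>)) (at \<tau> within {t..1})" if "t \<le> \<tau>" for \<tau> :: real
        using that t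
        by (intro field_vector_diff_chain_within[unfolded o_def] P')
           (auto intro!: derivative_eq_intros simp: U_def)
      moreover have "continuous_on {t..1} (\<lambda>\<tau>. \<i> * h x (of_real s + \<i> * of_real \<tau>))"
        using t by (intro continuous_on_compose2[OF contx] continuous_intros) (auto simp: U_def)
      ultimately have "(LINT \<tau>|lborel. indicator {t..1} \<tau> *\<^sub>R (\<i> * h x (of_real s + \<i> * of_real \<tau>)))
         = P (of_real s + \<i>) - P (of_real s + \<i> * of_real t)"
        using integral_FTC_Icc[of t 1 "\<lambda>\<tau>. P (of_real s + \<i> * of_real \<tau>)"
            "\<lambda>\<tau>. \<i> * h x (of_real s + \<i> * of_real \<tau>)"] t by simp
      then show ?thesis
        unfolding Ver_def by (simp flip: mult_scaleR_right)
    qed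
    show ?thesis
      using t by (simp add: right_diff_distrib H V)
  qed
  have "J 1 - J t = (LINT x|lborel. Hor 1 x - Hor t x)"
    using Hor t by simp
  also have "\<dots> = (LINT x|lborel. \<i> * (Ver 1 x - Ver 0 x))"
    by (simp add: rect)
  also have "\<dots> = 0" using Ver by simp
  finally show ?thesis by (simp add: J_def)
qed

section \<open>Narrowing Gaussians to a point\<close>

text \<open>The substitution x = a + u/m moves the parameter from the Gaussian into \<phi>, up to a
  nonzero Jacobian. A fixed Gaussian dominates the exponential growth, so the limit is \<phi>(a)
  times a nonzero integral.\<close>

lemma eq_0_if_integral_gaussians_0:
  fixes \<phi> :: "'a::euclidean_space \<Rightarrow> complex"
  assumes cont: "continuous_on UNIV \<phi>"
    and growth: "\<And>x. cmod (\<phi> x) \<le> A * exp (c * norm x)" and c: "0 \<le> c"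
    and int0: "\<And>m::nat. 1 \<le> m \<Longrightarrow>
      (LINT x|lborel. \<phi> x * of_real (exp (- (real m)\<^sup>2 * (norm (x - a))\<^sup>2))) = 0"
  shows "\<phi> a = 0"
proof -
  define e :: "'a \<Rightarrow> complex" where "e x = of_real (exp (- (norm x)\<^sup>2))" for x
  have [measurable]: "\<phi> \<in> borel_measurable borel"
    using cont by (rule borel_measurable_continuous_onI)
  have [measurable]: "e \<in> borel_measurable borel"
    unfolding e_def by (intro borel_measurable_continuous_onI continuous_intros)
  have zero: "(LINT u|lborel. \<phi> (a + (1 / real (Suc m)) *\<^sub>R u) * e u) = 0" for m
  proof -
    define r where "r = real (Suc m)"
    have r: "1 \<le> r" by (simp add: r_def)
    let ?g = "\<lambda>x. \<phi> x * of_real (exp (- r\<^sup>2 * (norm (x - a))\<^sup>2))"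
    have meas: "?g \<in> borel_measurable borel"
      by (intro borel_measurable_continuous_onI continuous_intros cont)
    have "0 = (LINT x|lborel. ?g x)"
      using int0[of "Suc m"] by (simp add: r_def)
    also have "\<dots> = \<bar>1 / r\<bar> ^ DIM('a) *\<^sub>R (LINT u|lborel. ?g (a + (1 / r) *\<^sub>R u))"
      using r meas
      by (subst lborel_affine[of "1 / r" a], simp, subst integral_density, simp, simp, simp,
          subst integral_distr) (auto)
    finally have "(LINT u|lborel. ?g (a + (1 / r) *\<^sub>R u)) = 0"
      using r by simp
    moreover have "?g (a + (1 / r) *\<^sub>R u) = \<phi> (a + (1 / r) *\<^sub>R u) * e u" for u
      using r by (simp add: e_def power_divide)
    ultimately show ?thesis by (simp only: r_def)
  qed
  \<comment> \<open>The second factor pays for moving the centre to a, since norm (a + r u) <= norm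
    a + norm u for 0 <= r <= 1. The third is the constant of \<open>gaussian_dominates\<close> for b
    = 0, \<beta> = 0 and k = 1.\<close>
  define D where "D = \<bar>A\<bar> * exp (c * norm a) * exp (c\<^sup>2 / 2)"
  have A: "A \<le> \<bar>A\<bar>" by simp
  have dom: "norm (\<phi> (a + r *\<^sub>R u) * e u) \<le> D * exp (- (norm u)\<^sup>2 / 4)" if r: "0 \<le> r" "r \<le> 1" for r u
  proof -
    have "norm (a + r *\<^sub>R u) \<le> norm a + norm u"
      using r by (intro norm_triangle_le) (simp add: mult_left_le_one_le)
    then have "c * norm (a + r *\<^sub>R u) \<le> c * norm a + c * norm u"
      using c by (simp add: distrib_left[symmetric] mult_left_mono)
    then have "exp (c * norm (a + r *\<^sub>R u)) \<le> exp (c * norm a) * exp (c * norm u)"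
      by (simp add: exp_add[symmetric])
    then have "cmod (\<phi> (a + r *\<^sub>R u)) \<le> \<bar>A\<bar> * (exp (c * norm a) * exp (c * norm u))"
      by (intro order_trans[OF growth] mult_mono) auto
    then have "norm (\<phi> (a + r *\<^sub>R u) * e u)
        \<le> \<bar>A\<bar> * (exp (c * norm a) * exp (c * norm u)) * exp (- (norm u)\<^sup>2)"
      by (auto simp: e_def norm_mult intro!: mult_right_mono)
    also have "\<dots> = \<bar>A\<bar> * exp (c * norm a) * (exp (c * norm u) * exp (- 1 * (norm (u - 0))\<^sup>2))"
      by simp
    also have "\<dots> \<le> \<bar>A\<bar> * exp (c * norm a) * (exp (c\<^sup>2 / 2) * exp (- (norm u)\<^sup>2 / 4))"
      using gaussian_dominates[of "0::'a" 0 c 1 u] c by (intro mult_left_mono) auto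
    finally show ?thesis by (simp add: D_def)
  qed
  have bint: "integrable lborel (\<lambda>u::'a. D * exp (- (norm u)\<^sup>2 / 4))"
    by (intro integrable_mult_right integrable_gaussian_euclidean)
  have "(\<lambda>m. LINT u|lborel. \<phi> (a + (1 / real (Suc m)) *\<^sub>R u) * e u)
      \<longlonglongrightarrow> (LINT u|lborel. \<phi> a * e u)"
  proof (rule integral_dominated_convergence[OF _ _ bint])
    show "AE u in lborel. (\<lambda>m. \<phi> (a + (1 / real (Suc m)) *\<^sub>R u) * e u) \<longlonglongrightarrow> \<phi> a * e u"
    proof (intro always_eventually allI tendsto_intros)
      fix u
      have "(\<lambda>m. a + (1 / real (Suc m)) *\<^sub>R u) \<longlonglongrightarrow> a + 0 *\<^sub>R u"
        using LIMSEQ_inverse_real_of_nat by (intro tendsto_intros) (simp add: field_simps)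
      then show "(\<lambda>m. \<phi> (a + (1 / real (Suc m)) *\<^sub>R u)) \<longlonglongrightarrow> \<phi> a"
        using cont by (intro isCont_tendsto_compose[of a \<phi>]) (auto simp: continuous_on_eq_continuous_at)
    qed
    show "AE u in lborel. norm (\<phi> (a + (1 / real (Suc m)) *\<^sub>R u) * e u) \<le> D * exp (- (norm u)\<^sup>2 / 4)" for m
      by (intro always_eventually allI dom) auto
  qed auto
  then have "(LINT u|lborel. \<phi> a * e u) = 0"
    using zero by (simp add: LIMSEQ_const_iff)
  moreover have "(LINT u|lborel. e u) \<noteq> 0"
  proof
    have ie: "integrable lborel (\<lambda>u::'a. exp (- (norm u)\<^sup>2))"
      by (rule Bochner_Integration.integrable_bound[OF integrable_gaussian_euclidean]) auto
    assume "(LINT u|lborel. e u) = 0"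
    then have "(LINT u|lborel. exp (- (norm (u::'a))\<^sup>2)) = 0"
      unfolding e_def integral_complex_of_real by simp
    then have "AE u::'a in lborel. exp (- (norm u)\<^sup>2) = 0"
      using integral_nonneg_eq_0_iff_AE[OF ie] by simp
    then show False by (simp add: eventually_False ae_filter_eq_bot_iff)
  qed
  ultimately show ?thesis by simp
qed

section \<open>Complex lines and holomorphy in several variables\<close>

lemma cvec_nth [simp]: "cvec x y $ j = Complex (x $ j) (y $ j)"
  by (simp add: cvec_def)

lemma continuous_on_cvec [continuous_intros]:
  assumes "continuous_on S f" "continuous_on S g"
  shows "continuous_on S (\<lambda>t. cvec (f t) (g t))"
  unfolding cvec_def Complex_eq using assms by (intro continuous_intros) auto

text \<open>Since v is real, Re \<zeta> moves only the base point and Im \<zeta> only the height.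
  This translates between the coordinates of the tube and one complex variable.\<close>

lemma cvec_add_line:
  "cvec (x + Re \<zeta> *\<^sub>R v) (w + Im \<zeta> *\<^sub>R v) = cvec x w + \<zeta> *s cvec v 0"
  by (simp add: vec_eq_iff complex_eq_iff)

lemma l1_norm_nonneg: "0 \<le> l1_norm z"
  by (simp add: l1_norm_def sum_nonneg)

lemma l1_norm_cvec_le:
  fixes x y :: "real ^ 'n"
  shows "l1_norm (cvec x y) \<le> real CARD('n) * (norm x + norm y)"
proof -
  have "l1_norm (cvec x y) \<le> (\<Sum>j\<in>(UNIV :: 'n set). norm x + norm y)"
    unfolding l1_norm_def
  proof (rule sum_mono)
    fix j :: 'n
    have "cmod (cvec x y $ j) \<le> \<bar>x $ j\<bar> + \<bar>y $ j\<bar>"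
      using cmod_le[of "cvec x y $ j"] by simp
    also have "\<dots> \<le> norm x + norm y"
      by (intro add_mono component_le_norm_cart)
    finally show "cmod (cvec x y $ j) \<le> norm x + norm y" .
  qed
  then show ?thesis by simp
qed

text \<open>Follows from 1 + u <= exp u. Polynomial growth is weakened to exponential growth, which
  \<open>gaussian_dominates\<close> absorbs at any rate.\<close>

lemma one_add_powr_le_exp:
  fixes u N :: real
  assumes "0 \<le> u" "0 \<le> N"
  shows "(1 + u) powr N \<le> exp (N * u)"
proof -
  have "(1 + u) powr N \<le> exp u powr N"
    using assms by (intro powr_mono2) auto
  then show ?thesis by (simp add: exp_powr_real mult.commute)
qed

text \<open>By the chain rule the increment is D (h *s w), and complex linearity makes this h * D w.
  Cauchy's theorem is thus needed in one variable only.\<close>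

lemma holomorphic_several_line:
  assumes "holomorphic_several F S" "p + \<zeta> *s w \<in> S"
  shows "(\<lambda>\<zeta>. F (p + \<zeta> *s w)) field_differentiable (at \<zeta>)"
proof -
  obtain D where D: "(F has_derivative D) (at (p + \<zeta> *s w))" "\<And>c v. D (c *s v) = c * D v"
    using assms unfolding holomorphic_several_def by blast
  have "bounded_linear (\<lambda>\<zeta>. \<zeta> *s w)"
    unfolding linear_conv_bounded_linear[symmetric]
    by (intro linearI) (auto simp: vec_eq_iff algebra_simps)
  then have "((\<lambda>\<zeta>. p + \<zeta> *s w) has_derivative (\<lambda>h. h *s w)) (at \<zeta>)"
    by (auto intro!: derivative_eq_intros bounded_linear_imp_has_derivative)
  from has_derivative_compose[OF this D(1)]
  have "((\<lambda>\<zeta>. F (p + \<zeta> *s w)) has_field_derivative D w) (at \<zeta>)"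
    by (simp add: D(2) has_field_derivative_def mult_commute_abs)
  then show ?thesis by (auto simp: field_differentiable_def)
qed

lemma holomorphic_several_imp_continuous_on:
  "holomorphic_several F S \<Longrightarrow> continuous_on S F"
  unfolding holomorphic_several_def
  by (meson continuous_at_imp_continuous_on has_derivative_continuous)

section \<open>Entire Gaussians as test functions\<close>

text \<open>The squares are complex, without moduli, which makes the function entire in z for any
  complex centre c.\<close>

definition gaussian :: "real \<Rightarrow> complex ^ 'n \<Rightarrow> complex ^ 'n \<Rightarrow> complex" where
  "gaussian k c z = exp (- of_real k * (\<Sum>j\<in>UNIV. (z $ j - c $ j)\<^sup>2))"

lemma norm_sq_cart: "(norm u)\<^sup>2 = (\<Sum>j\<in>UNIV. (u $ j)\<^sup>2)" for u :: "real ^ 'n"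
  by (simp add: norm_vec_def L2_set_def sum_nonneg)

text \<open>The real part of (z_j - c_j)^2 is (x_j - a_j)^2 - (y_j - v_j)^2: there is decay in real
  directions, and growth in imaginary ones that stays bounded on bounded sets of heights.\<close>

lemma norm_gaussian_cvec:
  "cmod (gaussian k (cvec a v) (cvec x y)) = exp (- k * (norm (x - a))\<^sup>2) * exp (k * (norm (y - v))\<^sup>2)"
  by (simp add: gaussian_def norm_sq_cart exp_add[symmetric] Re_power2 sum_subtractf algebra_simps)

text \<open>This is why the centre is a + iv: at height v the test function becomes a positive real
  Gaussian around a.\<close>

lemma gaussian_cvec_same:
  "gaussian k (cvec a v) (cvec x v) = of_real (exp (- k * (norm (x - a))\<^sup>2))"
proof -
  have "Complex (x $ j) (v $ j) - Complex (a $ j) (v $ j) = of_real ((x - a) $ j)" for j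
    by (simp add: complex_eq_iff)
  then show ?thesis
    by (simp add: gaussian_def norm_sq_cart exp_of_real[symmetric])
qed

lemma holomorphic_several_gaussian: "holomorphic_several (gaussian k c) S"
  unfolding holomorphic_several_def
proof (intro ballI exI conjI allI)
  fix z
  let ?D = "\<lambda>h. (- of_real k * (\<Sum>j\<in>UNIV. 2 * (z $ j - c $ j) * h $ j)) * gaussian k c z"
  have nth: "((\<lambda>z. z $ j) has_derivative (\<lambda>h. h $ j)) (at z)" for j
    by (rule bounded_linear_imp_has_derivative[OF bounded_linear_vec_nth])
  have "((\<lambda>z. - of_real k * (\<Sum>j\<in>UNIV. (z $ j - c $ j)\<^sup>2)) has_derivative
      (\<lambda>h. - of_real k * (\<Sum>j\<in>UNIV. 2 * (z $ j - c $ j) * h $ j))) (at z)"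
    by (rule derivative_eq_intros nth refl | simp add: algebra_simps)+
  from has_derivative_compose[OF this DERIV_exp[THEN has_field_derivative_imp_has_derivative]]
  show "(gaussian k c has_derivative ?D) (at z)"
    unfolding gaussian_def by (simp add: mult.commute)
  show "?D (b *s h) = b * ?D h" for b h
    by (simp add: sum_distrib_left mult_ac)
qed

text \<open>Over the compact set K the growth in y is at most the constant G. The polynomial weight
  is at most exponential in norm x, with rate c, and the decay in x beats it.\<close>

lemma gaussian_in_test_space:
  fixes a v :: "real ^ 'n"
  assumes k: "1 \<le> k"
  shows "gaussian k (cvec a v) \<in> test_space"
  unfolding test_space_def test_space_on_def
proof (intro CollectI allI impI conjI)
  fix K :: "(real ^ 'n) set" and N :: nat
  assume K: "compact K \<and> convex K"
  show "holomorphic_several (gaussian k (cvec a v)) (interior (tube K))"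
    by (rule holomorphic_several_gaussian)
  show "continuous_on (tube K) (gaussian k (cvec a v))"
    by (rule holomorphic_several_imp_continuous_on[OF holomorphic_several_gaussian])
  obtain R where R: "0 < R" "\<And>y. y \<in> K \<Longrightarrow> norm y \<le> R"
    using K compact_imp_bounded bounded_pos by metis
  define c where "c = real N * real CARD('n)"
  have c: "0 \<le> c" by (simp add: c_def)
  define E where "E = exp ((norm a)\<^sup>2 / 2 + c\<^sup>2 / 2 + c * norm a)"
  define G where "G = exp (k * (R + norm v)\<^sup>2)"
  show "bdd_above ((\<lambda>z. (1 + l1_norm z) ^ N * cmod (gaussian k (cvec a v) z)) ` tube K)"
  proof (rule bdd_aboveI2)
    fix z assume "z \<in> tube K"
    then obtain x y where z: "z = cvec x y" and y: "y \<in> K" by (auto simp: tube_def)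
    have "(1 + l1_norm z) ^ N \<le> exp (l1_norm z) ^ N"
      by (intro power_mono) (auto simp: l1_norm_nonneg)
    also have "\<dots> = exp (real N * l1_norm z)"
      by (simp add: exp_of_nat_mult)
    also have "\<dots> \<le> exp (c * norm x + c * R)"
    proof -
      have "real N * l1_norm z \<le> real N * (real CARD('n) * (norm x + R))"
        unfolding z using R(2)[OF y]
        by (intro mult_left_mono order_trans[OF l1_norm_cvec_le]) auto
      then show ?thesis by (simp add: c_def algebra_simps)
    qed
    finally have 1: "(1 + l1_norm z) ^ N \<le> exp (c * R) * exp (c * norm x)"
      by (simp add: exp_add[symmetric] add.commute)
    have "norm (y - v) \<le> R + norm v"
      using norm_triangle_ineq4[of y v] R(2)[OF y] by linarith
    then have 2: "exp (k * (norm (y - v))\<^sup>2) \<le> G"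
      unfolding G_def using k by (auto intro!: mult_left_mono power_mono)
    have "(1 + l1_norm z) ^ N * cmod (gaussian k (cvec a v) z)
        \<le> (exp (c * R) * exp (c * norm x)) * (exp (- k * (norm (x - a))\<^sup>2) * G)"
      unfolding z norm_gaussian_cvec using 1 2 by (intro mult_mono) (auto simp: z)
    also have "\<dots> = exp (c * R) * G * (exp (c * norm x) * exp (- k * (norm (x - a))\<^sup>2))"
      by simp
    also have "\<dots> \<le> exp (c * R) * G * (E * exp (- (norm x)\<^sup>2 / 4))"
      unfolding E_def using k c by (intro mult_left_mono gaussian_dominates) (auto simp: G_def)
    also have "\<dots> \<le> exp (c * R) * G * E"
      by (simp add: G_def E_def)
    finally show "(1 + l1_norm z) ^ N * cmod (gaussian k (cvec a v) z) \<le> exp (c * R) * G * E" .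
  qed
qed

section \<open>Cones and circular subcones\<close>

text \<open>A ball about 0 inside the cone would scale up to the whole space, which contains
  straight lines.\<close>

lemma proper_open_cone_zero:
  assumes "open_cone C" "proper_cone C"
  shows "0 \<notin> C"
proof
  assume 0: "0 \<in> C"
  then obtain e where e: "0 < e" "ball 0 e \<subseteq> C"
    using assms(1) unfolding open_cone_def by (meson openE)
  have "y \<in> C" for y
  proof (cases "y = 0")
    case False
    let ?t = "e / (2 * norm y)"
    have "norm (?t *\<^sub>R y) < e"
      using e False by simp
    then have "?t *\<^sub>R y \<in> C" using e by (auto simp: subset_iff)
    moreover have "0 < 1 / ?t" using e False by simp
    ultimately have "(1 / ?t) *\<^sub>R (?t *\<^sub>R y) \<in> C"
      using assms(1) unfolding open_cone_def by blast
    then show ?thesis using e False by simp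
  qed (use 0 in simp)
  moreover have "(1 :: real ^ 'a) \<noteq> 0" by simp
  ultimately show False
    using assms(2) unfolding proper_cone_def by blast
qed

text \<open>A sufficiently narrow circular cone around the ray through v works, because C is open at
  the unit vector u.\<close>

lemma compact_subcone_containing:
  assumes C: "open_cone C" and v: "v \<in> C" "v \<noteq> 0"
  obtains C' where "compact_subcone C' C" "v \<in> C'"
proof -
  define u where "u = (1 / norm v) *\<^sub>R v"
  have "u \<in> C" using C v unfolding open_cone_def u_def by (auto simp: divide_simps)
  then obtain e where e: "0 < e" "cball u e \<subseteq> C"
    using C unfolding open_cone_def by (meson open_contains_cball)
  \<comment> \<open>The condition says that y / norm y lies within e of u. Multiplied out it is
    visibly open and scale invariant, and the strict inequality excludes 0.\<close>
  define C' where "C' = {y. norm (y - norm y *\<^sub>R u) < e * norm y}"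
  have "open C'"
    unfolding C'_def by (intro open_Collect_less continuous_intros)
  moreover have "t *\<^sub>R y \<in> C'" if "0 < t" "y \<in> C'" for t y
  proof -
    have "t *\<^sub>R y - norm (t *\<^sub>R y) *\<^sub>R u = t *\<^sub>R (y - norm y *\<^sub>R u)"
      using that by (simp add: algebra_simps)
    then show ?thesis using that by (simp add: C'_def)
  qed
  moreover have "closure C' \<inter> sphere 0 1 \<subseteq> C \<inter> sphere 0 1"
  proof -
    \<comment> \<open>On the unit sphere the weak inequality means membership in
      \<open>cball u e\<close>; hence the choice of a closed ball inside C.\<close>
    have "closure C' \<subseteq> {y. norm (y - norm y *\<^sub>R u) \<le> e * norm y}"
      by (intro closure_minimal closed_Collect_le continuous_intros) (auto simp: C'_def)
    then show ?thesis
      using e(2) by (auto simp: subset_iff dist_norm norm_minus_commute)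
  qed
  ultimately have "compact_subcone C' C"
    unfolding compact_subcone_def open_cone_def by blast
  moreover have "v \<in> C'"
    using v e by (simp add: C'_def u_def)
  ultimately show ?thesis by (rule that)
qed

section \<open>Growth of f along a ray\<close>

text \<open>The rate c comes from N and the dimension alone and is fixed before t. Only A depends on
  t, because H is controlled only on compact parts of the ray.\<close>

lemma growth_space_ray_bound:
  fixes f :: "complex ^ 'n \<Rightarrow> complex"
  assumes f: "f \<in> growth_space C" and C: "open_cone C"
    and C': "compact_subcone C' C" and v: "v \<in> C'" "v \<in> C" "v \<noteq> 0"
  obtains c where "0 \<le> c"
    "\<forall>t>0. \<exists>A\<ge>0. \<forall>x. \<forall>\<tau>\<in>{t..1}. cmod (f (cvec x (\<tau> *\<^sub>R v))) \<le> A * exp (c * norm x)"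
proof -
  obtain N H where N: "0 \<le> N" and H: "continuous_on C H"
    and *: "\<And>C'. compact_subcone C' C \<Longrightarrow>
       \<exists>M. \<forall>r>0. \<forall>x. \<forall>y\<in>C' - (C' \<inter> ball 0 r).
          cmod (f (cvec x y)) \<le> M * (1 + l1_norm (cvec x y)) powr N * exp (H y)"
    using f unfolding growth_space_def by blast
  obtain M where "\<forall>r>0. \<forall>x. \<forall>y\<in>C' - (C' \<inter> ball 0 r).
      cmod (f (cvec x y)) \<le> M * (1 + l1_norm (cvec x y)) powr N * exp (H y)"
    using *[OF C'] by blast
  \<comment> \<open>M is chosen before r, so r = norm y may be taken separately for each y: the
    point y lies outside the open ball of that radius.\<close>
  then have M: "cmod (f (cvec x y)) \<le> M * (1 + l1_norm (cvec x y)) powr N * exp (H y)"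
    if "y \<in> C'" "y \<noteq> 0" for x y
    using that by (auto dest: spec[of _ "norm y"])
  define c where "c = N * real CARD('n)"
  have c: "0 \<le> c" using N by (simp add: c_def)
  moreover have "\<exists>A\<ge>0. \<forall>x. \<forall>\<tau>\<in>{t..1}. cmod (f (cvec x (\<tau> *\<^sub>R v))) \<le> A * exp (c * norm x)"
    if t: "0 < t" for t
  proof -
    have "continuous_on {t..1} (\<lambda>\<tau>. H (\<tau> *\<^sub>R v))"
      using C v t unfolding open_cone_def
      by (intro continuous_on_compose2[OF H] continuous_intros) auto
    then have "bounded ((\<lambda>\<tau>. H (\<tau> *\<^sub>R v)) ` {t..1})"
      by (intro compact_imp_bounded compact_continuous_image) auto
    then obtain R where "\<forall>\<tau>\<in>{t..1}. norm (H (\<tau> *\<^sub>R v)) \<le> R"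
      unfolding bounded_iff by blast
    then have R: "H (\<tau> *\<^sub>R v) \<le> R" if "\<tau> \<in> {t..1}" for \<tau>
      using that by fastforce
    define A where "A = \<bar>M\<bar> * exp (c * norm v) * exp R"
    have "cmod (f (cvec x (\<tau> *\<^sub>R v))) \<le> A * exp (c * norm x)" if \<tau>: "\<tau> \<in> {t..1}" for x \<tau>
    proof -
      let ?z = "cvec x (\<tau> *\<^sub>R v)"
      have in_C': "\<tau> *\<^sub>R v \<in> C'" "\<tau> *\<^sub>R v \<noteq> 0"
        using C' v \<tau> t unfolding compact_subcone_def open_cone_def by auto
      have "N * l1_norm ?z \<le> N * (real CARD('n) * (norm x + norm v))"
      proof (intro mult_left_mono order_trans[OF l1_norm_cvec_le])
        show "norm x + norm (\<tau> *\<^sub>R v) \<le> norm x + norm v"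
          using \<tau> t by (simp add: mult_left_le_one_le)
      qed (use N in auto)
      then have "(1 + l1_norm ?z) powr N \<le> exp (c * norm x + c * norm v)"
        using one_add_powr_le_exp[OF l1_norm_nonneg N, of ?z]
        by (auto simp: c_def algebra_simps elim: order_trans)
      then have "\<bar>M\<bar> * (1 + l1_norm ?z) powr N * exp (H (\<tau> *\<^sub>R v))
          \<le> \<bar>M\<bar> * exp (c * norm x + c * norm v) * exp R"
        using R[OF \<tau>] by (intro mult_mono) auto
      moreover have "cmod (f ?z) \<le> \<bar>M\<bar> * (1 + l1_norm ?z) powr N * exp (H (\<tau> *\<^sub>R v))"
        by (intro order_trans[OF M[OF in_C']] mult_right_mono) auto
      ultimately show ?thesis by (simp add: A_def exp_add mult_ac)
    qed
    moreover have "0 \<le> A" by (simp add: A_def)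
    ultimately show ?thesis by blast
  qed
  ultimately show ?thesis using that by blast
qed

section \<open>Shifting the pairing of f with a Gaussian\<close>

lemma gaussian_pairing_shift:
  fixes f :: "complex ^ 'n \<Rightarrow> complex" and a v :: "real ^ 'n"
  assumes hol: "holomorphic_several f (tube C')" and cone: "\<And>t. 0 < t \<Longrightarrow> t *\<^sub>R v \<in> C'"
    and t: "0 < t" "t \<le> 1" and k: "1 \<le> k" and c: "0 \<le> c" and A: "0 \<le> A"
    and bound: "\<And>x \<tau>. \<tau> \<in> {t..1} \<Longrightarrow> cmod (f (cvec x (\<tau> *\<^sub>R v))) \<le> A * exp (c * norm x)"
  shows "(LINT x|lborel. f (cvec x (t *\<^sub>R v)) * gaussian k (cvec a v) (cvec x 0))
    = (LINT x|lborel. f (cvec x v) * gaussian k (cvec a v) (cvec x ((1 - t) *\<^sub>R v)))"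
proof -
  define w where "w = cvec v 0"
  \<comment> \<open>The offset -t v makes the Gaussian start at height 0 when f is at height t v.
    Raising Im \<zeta> from t to 1 takes f to height v and the Gaussian to height (1 - t) v.\<close>
  define p where "p x = cvec x (- t *\<^sub>R v)" for x
  define h where "h x \<zeta> = f (cvec x 0 + \<zeta> *s w) * gaussian k (cvec a v) (p x + \<zeta> *s w)" for x \<zeta>
  have h: "h x \<zeta> = f (cvec (x + Re \<zeta> *\<^sub>R v) (Im \<zeta> *\<^sub>R v)) *
      gaussian k (cvec a v) (cvec (x + Re \<zeta> *\<^sub>R v) ((Im \<zeta> - t) *\<^sub>R v))" for x \<zeta>
    using cvec_add_line[of x \<zeta> v 0] cvec_add_line[of x \<zeta> v "- t *\<^sub>R v"]
    by (simp add: h_def w_def p_def algebra_simps)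
  have in_tube: "cvec x 0 + \<zeta> *s w \<in> tube C'" if "0 < Im \<zeta>" for x \<zeta>
    unfolding tube_def w_def cvec_add_line[symmetric] using cone[OF that] by auto
  \<comment> \<open>The horizontal displacement s v is moved into the centre, giving a - s v. For 0
    <= s <= 1 these centres have norm at most \<beta>, so B is a majorant on the whole
    rectangle.\<close>
  define \<beta> where "\<beta> = norm a + norm v"
  define B where "B x = A * exp (c * norm v) * exp (k * (norm v)\<^sup>2) *
      (exp (\<beta>\<^sup>2 / 2 + c\<^sup>2 / 2 + c * \<beta>) * exp (- (norm x)\<^sup>2 / 4))" for x :: "real ^ 'n"
  have "(LINT x|lborel. h x (\<i> * of_real t)) = (LINT x|lborel. h x \<i>)"
  proof (rule integral_contour_shift[of _ v _ B])
    show "h x (of_real s + \<zeta>) = h (x + s *\<^sub>R v) \<zeta>" for x s \<zeta>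
      by (simp add: h scaleR_left_distrib add.assoc)
    have "h x field_differentiable (at \<zeta>)" if "0 < Im \<zeta>" for x \<zeta>
      unfolding h_def using in_tube[OF that]
      by (intro field_differentiable_mult holomorphic_several_line[OF hol]
          holomorphic_several_line[OF holomorphic_several_gaussian[of _ _ UNIV]]) auto
    then show "h x holomorphic_on {\<zeta>. 0 < Im \<zeta>}" for x
      by (auto simp: holomorphic_on_def intro: field_differentiable_at_within)
    have line: "continuous_on S (\<lambda>(x, \<zeta>). cvec x y + \<zeta> *s w)" for S and y
      unfolding split_beta vector_scalar_mult_def
      by (intro continuous_intros)
    have "continuous_on (UNIV \<times> {\<zeta>. 0 < Im \<zeta>}) (\<lambda>(x, \<zeta>). f (cvec x 0 + \<zeta> *s w))"
      using in_tube
      by (auto simp: split_beta intro!: continuous_on_compose2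
          [OF holomorphic_several_imp_continuous_on[OF hol] line[unfolded split_beta]])
    moreover have "continuous_on (UNIV \<times> {\<zeta>. 0 < Im \<zeta>}) (\<lambda>(x, \<zeta>). gaussian k (cvec a v) (p x + \<zeta> *s w))"
      unfolding p_def
      by (auto simp: split_beta intro!: continuous_on_compose2
          [OF holomorphic_several_imp_continuous_on[OF holomorphic_several_gaussian] line[unfolded split_beta]])
    ultimately show "continuous_on (UNIV \<times> {\<zeta>. 0 < Im \<zeta>}) (case_prod h)"
      unfolding h_def split_beta by (intro continuous_on_mult)
    show "integrable lborel B"
      unfolding B_def by (intro integrable_mult_right integrable_gaussian_euclidean)
    fix x and s \<tau> :: real
    assume s: "0 \<le> s" "s \<le> 1" and \<tau>: "t \<le> \<tau>" "\<tau> \<le> 1"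
    let ?x = "x + s *\<^sub>R v"
    have sv: "norm (s *\<^sub>R v) \<le> norm v"
      using s by (simp add: mult_left_le_one_le)
    have "c * norm ?x \<le> c * norm v + c * norm x"
      using norm_triangle_ineq[of x "s *\<^sub>R v"] sv c
      by (simp add: distrib_left[symmetric] mult_left_mono)
    then have "exp (c * norm ?x) \<le> exp (c * norm v) * exp (c * norm x)"
      by (simp add: exp_add[symmetric])
    then have 1: "cmod (f (cvec ?x (\<tau> *\<^sub>R v))) \<le> A * (exp (c * norm v) * exp (c * norm x))"
      using \<tau> A by (intro order_trans[OF bound] mult_left_mono) auto
    have "(\<tau> - t) *\<^sub>R v - v = (\<tau> - t - 1) *\<^sub>R v"
      by (simp add: algebra_simps)
    moreover have "norm ((\<tau> - t - 1) *\<^sub>R v) \<le> norm v"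
      using \<tau> t by (simp add: mult_left_le_one_le abs_if)
    ultimately have "k * (norm ((\<tau> - t) *\<^sub>R v - v))\<^sup>2 \<le> k * (norm v)\<^sup>2"
      using k by (intro mult_left_mono power_mono) auto
    then have 2: "cmod (gaussian k (cvec a v) (cvec ?x ((\<tau> - t) *\<^sub>R v)))
        \<le> exp (- k * (norm (x - (a - s *\<^sub>R v)))\<^sup>2) * exp (k * (norm v)\<^sup>2)"
      unfolding norm_gaussian_cvec by (auto simp: algebra_simps)
    have "norm (a - s *\<^sub>R v) \<le> \<beta>"
      using norm_triangle_ineq4[of a "s *\<^sub>R v"] sv by (simp add: \<beta>_def)
    from gaussian_dominates[OF this c k, of x] have 3: "exp (c * norm x) * exp (- k * (norm (x - (a - s *\<^sub>R v)))\<^sup>2)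
        \<le> exp (\<beta>\<^sup>2 / 2 + c\<^sup>2 / 2 + c * \<beta>) * exp (- (norm x)\<^sup>2 / 4)" .
    have "cmod (h x (of_real s + \<i> * of_real \<tau>))
        \<le> (A * (exp (c * norm v) * exp (c * norm x))) *
          (exp (- k * (norm (x - (a - s *\<^sub>R v)))\<^sup>2) * exp (k * (norm v)\<^sup>2))"
      unfolding h norm_mult using 1 2 A by (intro mult_mono) auto
    also have "\<dots> = A * exp (c * norm v) * exp (k * (norm v)\<^sup>2) *
        (exp (c * norm x) * exp (- k * (norm (x - (a - s *\<^sub>R v)))\<^sup>2))"
      by simp
    also have "\<dots> \<le> B x"
      unfolding B_def using 3 A by (intro mult_left_mono) auto
    finally show "cmod (h x (of_real s + \<i> * of_real \<tau>)) \<le> B x" .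
  qed (use t in auto)
  then show ?thesis by (simp add: h)
qed

section \<open>Vanishing at each point of the tube\<close>

theorem theorem6p3:
  fixes C :: "(real ^ 'n) set"
    and f :: "complex ^ 'n \<Rightarrow> complex"
    and U :: "(complex ^ 'n \<Rightarrow> complex) \<Rightarrow> complex"
  assumes "open_cone C" and "convex_cone_sum C" and "proper_cone C"
    and "f \<in> growth_space C"
    and "has_boundary_value C f U"
    and "\<forall>\<psi>\<in>test_space. U \<psi> = 0"
  shows "\<forall>z\<in>tube C. f z = 0"
proof
  fix z assume "z \<in> tube C"
  then obtain a v where z: "z = cvec a v" and v: "v \<in> C" by (auto simp: tube_def)
  have v0: "v \<noteq> 0" using v proper_open_cone_zero[OF assms(1,3)] by auto
  obtain C' where C': "compact_subcone C' C" "v \<in> C'"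
    using compact_subcone_containing[OF assms(1) v v0] .
  have ray: "t *\<^sub>R v \<in> C'" if "0 < t" for t
    using C' that unfolding compact_subcone_def open_cone_def by blast
  have hol: "holomorphic_several f (tube C')"
    using assms(4) C'(1) unfolding growth_space_def by blast
  obtain c where c: "0 \<le> c"
    and growth: "\<forall>t>0. \<exists>A\<ge>0. \<forall>x. \<forall>\<tau>\<in>{t..1}. cmod (f (cvec x (\<tau> *\<^sub>R v))) \<le> A * exp (c * norm x)"
    using growth_space_ray_bound[OF assms(4,1) C' v v0] by blast
  obtain A where A: "0 \<le> A" "\<And>x. cmod (f (cvec x v)) \<le> A * exp (c * norm x)"
    using growth[rule_format, of 1] by auto
  have cont: "continuous_on UNIV (\<lambda>x. f (cvec x v))"
    using C'(2) by (intro continuous_on_compose2[OF holomorphic_several_imp_continuous_on[OF hol]]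
        continuous_intros) (auto simp: tube_def)
  have "f (cvec a v) = 0"
  proof (rule eq_0_if_integral_gaussians_0[OF cont A(2) c])
    fix m :: nat assume "1 \<le> m"
    \<comment> \<open>The square matches the scaling x = a + u/m of
      \<open>eq_0_if_integral_gaussians_0\<close>.\<close>
    define k where "k = (real m)\<^sup>2"
    have k: "1 \<le> k" using \<open>1 \<le> m\<close> by (simp add: k_def)
    define \<psi> where "\<psi> = gaussian k (cvec a v)"
    \<comment> \<open>The shift to height 1 needs 0 < t <= 1; \<open>Suc n\<close> keeps the
      sequence in this range from n = 0 on.\<close>
    define t where "t n = 1 / real (Suc n)" for n
    have t: "0 < t n" "t n \<le> 1" for n by (auto simp: t_def)
    have t0: "t \<longlonglongrightarrow> 0"
      unfolding t_def using LIMSEQ_inverse_real_of_nat by (simp add: field_simps)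
    have \<psi>: "\<psi> \<in> test_space"
      unfolding \<psi>_def by (rule gaussian_in_test_space[OF k])
    have "((\<lambda>y. LINT x|lborel. f (cvec x y) * \<psi> (cvec x 0)) \<longlongrightarrow> 0) (at 0 within C')"
    proof -
      have "((\<lambda>y. LINT x|lborel. f (cvec x y) * \<psi> (cvec x 0)) \<longlongrightarrow> U \<psi>) (at 0 within C')"
        using assms(5) \<psi> C'(1) unfolding has_boundary_value_def by blast
      then show ?thesis using assms(6) \<psi> by simp
    qed
    moreover have "filterlim (\<lambda>n. t n *\<^sub>R v) (at 0 within C') sequentially"
    proof -
      have "(\<lambda>n. t n *\<^sub>R v) \<longlonglongrightarrow> 0 *\<^sub>R v" by (intro tendsto_intros t0)
      moreover have "t n *\<^sub>R v \<in> C'" "t n \<noteq> 0" for n using t[of n] by (auto intro: ray)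
      ultimately show ?thesis
        using v0 unfolding filterlim_at by (auto intro!: always_eventually)
    qed
    ultimately have "(\<lambda>n. LINT x|lborel. f (cvec x (t n *\<^sub>R v)) * \<psi> (cvec x 0)) \<longlonglongrightarrow> 0"
      by (rule filterlim_compose)
    moreover have "(LINT x|lborel. f (cvec x (t n *\<^sub>R v)) * \<psi> (cvec x 0))
        = (LINT x|lborel. f (cvec x v) * \<psi> (cvec x ((1 - t n) *\<^sub>R v)))" for n
    proof -
      \<comment> \<open>The constant A' may grow with n. It only justifies the shift and does not
        enter the limit below.\<close>
      obtain A' where "0 \<le> A'"
        "\<And>x \<tau>. \<tau> \<in> {t n..1} \<Longrightarrow> cmod (f (cvec x (\<tau> *\<^sub>R v))) \<le> A' * exp (c * norm x)"
        using growth[rule_format, OF t(1)[of n]] by blast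
      then show ?thesis
        unfolding \<psi>_def by (intro gaussian_pairing_shift[OF hol ray t k c])
    qed
    ultimately have lim0: "(\<lambda>n. LINT x|lborel. f (cvec x v) * \<psi> (cvec x ((1 - t n) *\<^sub>R v))) \<longlonglongrightarrow> 0"
      by simp
    have \<psi>_cont: "continuous_on UNIV \<psi>"
      unfolding \<psi>_def by (rule holomorphic_several_imp_continuous_on[OF holomorphic_several_gaussian])
    have meas: "(\<lambda>x. f (cvec x v) * \<psi> (cvec x y)) \<in> borel_measurable lborel" for y
    proof -
      have "continuous_on UNIV (\<lambda>x. f (cvec x v) * \<psi> (cvec x y))"
        by (intro continuous_on_mult cont continuous_on_compose2[OF \<psi>_cont] continuous_intros) auto
      then show ?thesis by (simp add: borel_measurable_continuous_onI)
    qed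
    \<comment> \<open>Here A bounds f at the single height v, and the Gaussian stays within norm v
      of its central height, so D is independent of n.\<close>
    define D where "D = A * exp (k * (norm v)\<^sup>2) * exp ((norm a)\<^sup>2 / 2 + c\<^sup>2 / 2 + c * norm a)"
    have bint: "integrable lborel (\<lambda>x::real ^ 'n. D * exp (- (norm x)\<^sup>2 / 4))"
      by (intro integrable_mult_right integrable_gaussian_euclidean)
    have "(\<lambda>n. LINT x|lborel. f (cvec x v) * \<psi> (cvec x ((1 - t n) *\<^sub>R v)))
        \<longlonglongrightarrow> (LINT x|lborel. f (cvec x v) * \<psi> (cvec x v))"
    proof (rule integral_dominated_convergence[OF meas meas bint])
      show "AE x in lborel. (\<lambda>n. f (cvec x v) * \<psi> (cvec x ((1 - t n) *\<^sub>R v))) \<longlonglongrightarrow> f (cvec x v) * \<psi> (cvec x v)"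
      proof (intro always_eventually allI tendsto_mult tendsto_const)
        fix x
        have "continuous_on UNIV (\<lambda>s. \<psi> (cvec x ((1 - s) *\<^sub>R v)))"
          by (intro continuous_on_compose2[OF \<psi>_cont] continuous_intros) auto
        then have "isCont (\<lambda>s. \<psi> (cvec x ((1 - s) *\<^sub>R v))) 0"
          by (simp add: continuous_on_eq_continuous_at)
        from isCont_tendsto_compose[OF this t0]
        show "(\<lambda>n. \<psi> (cvec x ((1 - t n) *\<^sub>R v))) \<longlonglongrightarrow> \<psi> (cvec x v)" by simp
      qed
      show "AE x in lborel. norm (f (cvec x v) * \<psi> (cvec x ((1 - t n) *\<^sub>R v))) \<le> D * exp (- (norm x)\<^sup>2 / 4)" for n
      proof (intro always_eventually allI)
        fix x
        have "norm ((1 - t n) *\<^sub>R v - v) = t n * norm v"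
          using t[of n] by (simp add: scaleR_left_diff_distrib)
        also have "\<dots> \<le> norm v" using t[of n] by (simp add: mult_left_le_one_le)
        finally have "exp (k * (norm ((1 - t n) *\<^sub>R v - v))\<^sup>2) \<le> exp (k * (norm v)\<^sup>2)"
          using k by (auto intro!: mult_left_mono power_mono)
        then have "norm (f (cvec x v) * \<psi> (cvec x ((1 - t n) *\<^sub>R v)))
            \<le> (A * exp (c * norm x)) * (exp (- k * (norm (x - a))\<^sup>2) * exp (k * (norm v)\<^sup>2))"
          unfolding \<psi>_def norm_mult norm_gaussian_cvec
          using A by (intro mult_mono mult_left_mono) auto
        also have "\<dots> = A * exp (k * (norm v)\<^sup>2) * (exp (c * norm x) * exp (- k * (norm (x - a))\<^sup>2))"
          by simp
        also have "\<dots> \<le> A * exp (k * (norm v)\<^sup>2) *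
            (exp ((norm a)\<^sup>2 / 2 + c\<^sup>2 / 2 + c * norm a) * exp (- (norm x)\<^sup>2 / 4))"
          using A(1) c k by (intro mult_left_mono gaussian_dominates) auto
        finally show "norm (f (cvec x v) * \<psi> (cvec x ((1 - t n) *\<^sub>R v))) \<le> D * exp (- (norm x)\<^sup>2 / 4)"
          by (simp add: D_def mult_ac)
      qed
    qed
    then have "(LINT x|lborel. f (cvec x v) * \<psi> (cvec x v)) = 0"
      using lim0 LIMSEQ_unique by blast
    then show "(LINT x|lborel. f (cvec x v) * of_real (exp (- (real m)\<^sup>2 * (norm (x - a))\<^sup>2))) = 0"
      by (simp only: \<psi>_def gaussian_cvec_same k_def)
  qed
  then show "f z = 0" by (simp add: z)
qed

end
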